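(* Let $a<b$ be real numbers and let $\mu$ be Lebesgue measure on $[a,b]$. Suppose that one of the following conditions holds: (a) $\Phi$ is an $N$-function and $f\in L^\infty([a,b])$; (b) $\Phi$ is an $N_\infty$-function and $f\in L^\Phi([a,b])$. Assume $f\notin M_\Phi$. Let $x_0\in(a,b)$ be a point of approximate continuity of $f$. Then every best approximant $g^*\in\mu_\Phi(f/M_\Phi)$ is continuous at $x_0$.
   Context: Class $\mathcal F$: functions $\varphi:[0,\infty)\to[0,\infty)$ that are non-decreasing, continuous, positive for $t>0$, with $\varphi(0^+)=0$ and $\lim_{t\to\infty}\varphi(t)=\infty$. Class $\mathcal F_\infty$: functions $\varphi:[0,\infty)\to[0,\infty)$ that are bounded, non-decreasing, continuous, positive for $t>0$, with $\varphi(0^+)=0$. An $N$-function (resp. $N_\infty$-function) is a convex function $\Phi(x)=\int_0^x\varphi(t)\,dt$, $x\ge 0$, for some $\varphi\in\mathcal F$ (resp. $\varphi\in\mathcal F_\infty$). All $N$-functions and $N_\infty$-functions are assumed to satisfy the $\Delta_2$ condition: there is a constant $K_2>0$ with $\Phi(2x)\le K_2\Phi(x)$ for all $x\ge 0$. $L^\Phi=L^\Phi([a,b])$ is the space of (a.e.-equivalence classes of) measurable functions $f$ on $[a,b]$ with $\int_a^b\Phi(|f|)\,d\mu<\infty$. $M_\Phi$ is the set of all non-decreasing functions in $L^\Phi([a,b])$ (up to a.e. equality). Pointwise properties of an element of $M_\Phi$ refer to a non-decreasing representative, real-valued on $(a,b)$. For $f\in L^\Phi$, $\mu_\Phi(f/M_\Phi)$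 denotes the set of best $\Phi$-approximants to $f$ from $M_\Phi$, i.e. of all $g^*\in M_\Phi$ with $\int_a^b\Phi(|f-g^*|)\,d\mu=\inf_{g\in M_\Phi}\int_a^b\Phi(|f-g|)\,d\mu$. Approximate continuity: for a measurable function $f$ on $[a,b]$ (a fixed pointwise-defined function), $x_0\in(a,b)$ is a point of approximate continuity of $f$ if for every $\delta>0$ the set $A_\delta=\{x\in[a,b]:|f(x)-f(x_0)|<\delta\}$ has metric density $1$ at $x_0$, that is, $\mu(A_\delta\cap I)/\mu(I)\to 1$ as $\mu(I)\to 0$, where $I$ ranges over the intervals containing $x_0$. *)

theory Defs
  imports "HOL-Analysis.Analysis"
begin

text \<open>
  Functions on \<open>[0, \<infinity>)\<close> and on \<open>[a, b]\<close> are modelled by total functions \<^typ>\<open>real \<Rightarrow> real\<close>;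
  no definition below depends on values outside those sets.
\<close>

definition class_F :: "(real \<Rightarrow> real) set" where
  "class_F = {\<phi>. (\<forall>t\<ge>0. \<phi> t \<ge> 0) \<and> mono_on {0..} \<phi> \<and> continuous_on {0..} \<phi> \<and>
     (\<forall>t>0. \<phi> t > 0) \<and> (\<phi> \<longlongrightarrow> 0) (at_right 0) \<and> filterlim \<phi> at_top at_top}"

definition class_F_inf :: "(real \<Rightarrow> real) set" where
  "class_F_inf = {\<phi>. (\<forall>t\<ge>0. \<phi> t \<ge> 0) \<and> bounded (\<phi> ` {0..}) \<and> mono_on {0..} \<phi> \<and>
     continuous_on {0..} \<phi> \<and> (\<forall>t>0. \<phi> t > 0) \<and> (\<phi> \<longlongrightarrow> 0) (at_right 0)}"

definition N_function :: "(real \<Rightarrow> real) \<Rightarrow> bool" where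
  "N_function \<Phi> \<longleftrightarrow> convex_on {0..} \<Phi> \<and> (\<exists>\<phi>\<in>class_F. \<forall>x\<ge>0. \<Phi> x = integral {0..x} \<phi>)"

definition N_inf_function :: "(real \<Rightarrow> real) \<Rightarrow> bool" where
  "N_inf_function \<Phi> \<longleftrightarrow> convex_on {0..} \<Phi> \<and> (\<exists>\<phi>\<in>class_F_inf. \<forall>x\<ge>0. \<Phi> x = integral {0..x} \<phi>)"

definition Delta2 :: "(real \<Rightarrow> real) \<Rightarrow> bool" where
  "Delta2 \<Phi> \<longleftrightarrow> (\<exists>K>0. \<forall>x\<ge>0. \<Phi> (2 * x) \<le> K * \<Phi> x)"

text \<open>
  The spaces consist of functions rather than of a.e.-equivalence classes; they are closed under
  a.e. equality on \<open>[a, b]\<close>.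
\<close>

definition L_Phi :: "real \<Rightarrow> real \<Rightarrow> (real \<Rightarrow> real) \<Rightarrow> (real \<Rightarrow> real) set" where
  "L_Phi a b \<Phi> = {f \<in> borel_measurable (lebesgue_on {a..b}).
     integrable (lebesgue_on {a..b}) (\<lambda>x. \<Phi> \<bar>f x\<bar>)}"

definition L_infinity :: "real \<Rightarrow> real \<Rightarrow> (real \<Rightarrow> real) set" where
  "L_infinity a b = {f \<in> borel_measurable (lebesgue_on {a..b}).
     \<exists>C. AE x in lebesgue_on {a..b}. \<bar>f x\<bar> \<le> C}"

text \<open>
  Monotonicity is required on the open interval only: an element of \<open>M_\<Phi>\<close> may be unbounded near
  \<open>a\<close> or \<open>b\<close>, in which case a non-decreasing representative on \<open>[a, b]\<close> is infinite there.
\<close>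

definition nondecreasing_rep ::
    "real \<Rightarrow> real \<Rightarrow> (real \<Rightarrow> real) \<Rightarrow> (real \<Rightarrow> real) \<Rightarrow> bool" where
  "nondecreasing_rep a b g h \<longleftrightarrow>
     mono_on {a<..<b} h \<and> (AE x in lebesgue_on {a..b}. g x = h x)"

definition M_Phi :: "real \<Rightarrow> real \<Rightarrow> (real \<Rightarrow> real) \<Rightarrow> (real \<Rightarrow> real) set" where
  "M_Phi a b \<Phi> = {g \<in> L_Phi a b \<Phi>. \<exists>h. nondecreasing_rep a b g h}"

text \<open>
  For \<open>f\<close>, \<open>g\<close> in \<open>L\<^sup>\<Phi>\<close> the integrand is integrable by monotonicity of \<open>\<Phi>\<close> and the \<open>\<Delta>\<^sub>2\<close> condition,
  so the Bochner integral takes no default values here.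
\<close>

definition Phi_distance ::
    "real \<Rightarrow> real \<Rightarrow> (real \<Rightarrow> real) \<Rightarrow> (real \<Rightarrow> real) \<Rightarrow> (real \<Rightarrow> real) \<Rightarrow> real" where
  "Phi_distance a b \<Phi> f g = (LINT x|lebesgue_on {a..b}. \<Phi> \<bar>f x - g x\<bar>)"

definition best_approximants ::
    "real \<Rightarrow> real \<Rightarrow> (real \<Rightarrow> real) \<Rightarrow> (real \<Rightarrow> real) \<Rightarrow> (real \<Rightarrow> real) set" where
  "best_approximants a b \<Phi> f =
     {g \<in> M_Phi a b \<Phi>. Phi_distance a b \<Phi> f g = (INF u\<in>M_Phi a b \<Phi>. Phi_distance a b \<Phi> f u)}"

text \<open>
  In the next filter the intervals around \<open>x\<close> shrink through positive lengths. Degenerate intervals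
  are thereby excluded, and so are intervals of infinite length, on which \<^const>\<open>measure\<close> is \<open>0\<close>.
\<close>

definition shrinking_intervals :: "real \<Rightarrow> real set filter" where
  "shrinking_intervals x =
     inf (filtercomap (measure lebesgue) (at_right 0)) (principal {I. is_interval I \<and> x \<in> I})"

definition has_metric_density :: "real set \<Rightarrow> real \<Rightarrow> real \<Rightarrow> bool" where
  "has_metric_density A d x \<longleftrightarrow>
     ((\<lambda>I. measure lebesgue (A \<inter> I) / measure lebesgue I) \<longlongrightarrow> d) (shrinking_intervals x)"

definition approx_continuous_at :: "real \<Rightarrow> real \<Rightarrow> (real \<Rightarrow> real) \<Rightarrow> real \<Rightarrow> bool" where
  "approx_continuous_at a b f x0 \<longleftrightarrow>
     (\<forall>\<delta>>0. has_metric_density {x \<in> {a..b}. \<bar>f x - f x0\<bar> < \<delta>} 1 x0)"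

end

theory Submission
  imports Defs
begin

text \<open>
  Suppose that a non-decreasing representative \<open>h\<close> of a best approximant jumps at \<open>x0\<close>: there are
  \<open>l < r\<close> with \<open>h \<le> l\<close> to the left of \<open>x0\<close> and \<open>h \<ge> r\<close> to the right. The number \<open>f x0\<close> cannot be
  both \<open>\<le> l\<close> and \<open>\<ge> r\<close>. If \<open>f x0 > l\<close>, replace \<open>h\<close> on a short interval \<open>I = [x0 - e, x0]\<close> by the
  constant \<open>m = min (f x0) r\<close>, and if \<open>f x0 \<le> l\<close>, replace it on a short interval \<open>I = [x0, x0 + e]\<close>
  by \<open>m = l\<close>. As \<open>m\<close> lies in the gap \<open>[l, r]\<close>, the new function is still
  non-decreasing (\<open>isCont_best_approximant\<close>), and a.e. on \<open>I\<close> it is nearer to \<open>f x0\<close> than \<open>h\<close> was, by a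
  fixed amount.

  On the part of \<open>I\<close> where \<open>f\<close> is close to \<open>f x0\<close> the integrand \<open>\<Phi> \<bar>f - h\<bar>\<close> therefore drops by at least
  some \<open>\<kappa> > 0\<close>, because \<open>\<Phi>\<close> is strictly increasing. On the rest of \<open>I\<close> it may grow, but by at most a
  constant \<open>C\<close>. Each of the two alternatives in the hypotheses provides such a \<open>C\<close>: if \<open>f\<close> is
  bounded, all arguments of \<open>\<Phi>\<close> stay in a bounded interval, and if \<open>\<phi>\<close> is bounded, then \<open>\<Phi>\<close> is
  Lipschitz. Approximate continuity makes the second part a vanishing fraction of \<open>I\<close> as \<open>I\<close> shrinks,
  so that the gain outweighs the loss (\<open>Phi_distance_improvement\<close>), which contradicts optimality.
\<close>

section \<open>Growth and integrability\<close>

text \<open>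
  The bound on increments is the mean value estimate: \<open>\<Phi>\<close> is Lipschitz when \<open>\<phi>\<close> is bounded.
\<close>

lemma
  assumes \<phi>: "continuous_on {0..} \<phi>" and pos: "\<And>t. t > 0 \<Longrightarrow> \<phi> t > (0::real)" and "\<phi> 0 \<ge> 0"
    and \<Phi>: "\<And>x. x \<ge> 0 \<Longrightarrow> \<Phi> x = integral {0..x} \<phi>"
  shows primitive_strict_mono_on: "strict_mono_on {0..} \<Phi>"
    and primitive_nonneg: "\<And>x. x \<ge> 0 \<Longrightarrow> \<Phi> x \<ge> 0"
    and primitive_increment_le:
      "\<And>K s t. (\<And>x. x \<ge> 0 \<Longrightarrow> \<phi> x \<le> K) \<Longrightarrow> 0 \<le> s \<Longrightarrow> s \<le> t \<Longrightarrow> \<Phi> t - \<Phi> s \<le> K * (t - s)"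
proof -
  have nonneg: "\<phi> t \<ge> 0" if "t \<ge> 0" for t
    using pos[of t] \<open>\<phi> 0 \<ge> 0\<close> that by (cases "t = 0") auto
  have int: "\<phi> integrable_on {s..t}" if "0 \<le> s" for s t
    using \<phi> that by (intro integrable_continuous_interval) (auto elim: continuous_on_subset)
  have diff: "\<Phi> t - \<Phi> s = integral {s..t} \<phi>" if "0 \<le> s" "s \<le> t" for s t
    using Henstock_Kurzweil_Integration.integral_combine[of 0 s t \<phi>] that int[of 0 t] \<Phi>[of s] \<Phi>[of t] by simp
  show "strict_mono_on {0..} \<Phi>"
  proof (rule strict_mono_onI)
    fix s t :: real assume st: "s \<in> {0..}" "s < t"
    \<comment> \<open>\<open>\<phi> 0\<close> may vanish; moving away from \<open>s\<close> gives \<open>\<phi>\<close> a positive minimum even when \<open>s = 0\<close>.\<close>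
    define p where "p = (s + t) / 2"
    have p: "0 < p" "s < p" "p < t" using st by (auto simp: p_def)
    obtain z where z: "z \<in> {p..t}" "\<And>y. y \<in> {p..t} \<Longrightarrow> \<phi> z \<le> \<phi> y"
      using continuous_attains_inf[of "{p..t}" \<phi>] continuous_on_subset[OF \<phi>, of "{p..t}"] p by auto
    have "0 < \<phi> z * (t - p)" using z p pos[of z] by auto
    also have "\<dots> = integral {p..t} (\<lambda>_. \<phi> z)" using p by simp
    also have "\<dots> \<le> integral {p..t} \<phi>"
      using z p int[of p t] by (intro integral_le) auto
    also have "\<dots> = \<Phi> t - \<Phi> p" using diff[of p t] p by simp
    also have "\<dots> \<le> \<Phi> t - \<Phi> s"
      using diff[of s p] integral_nonneg[OF int[of s p]] nonneg st p by force
    finally show "\<Phi> s < \<Phi> t" by simp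
  qed
  show "\<Phi> x \<ge> 0" if "x \<ge> 0" for x
    using \<Phi>[OF that] integral_nonneg[OF int[of 0 x]] nonneg by auto
  show "\<Phi> t - \<Phi> s \<le> K * (t - s)" if "\<And>x. x \<ge> 0 \<Longrightarrow> \<phi> x \<le> K" "0 \<le> s" "s \<le> t" for K s t
  proof -
    have "integral {s..t} \<phi> \<le> integral {s..t} (\<lambda>_. K)"
      using that int by (intro integral_le) auto
    then show ?thesis using diff that by (simp add: mult.commute)
  qed
qed

lemma borel_measurable_Phi_abs:
  assumes "mono_on {0..} (\<Phi> :: real \<Rightarrow> real)" and "f \<in> borel_measurable M"
  shows "(\<lambda>x. \<Phi> \<bar>f x :: real\<bar>) \<in> borel_measurable M"
proof -
  \<comment> \<open>Only values of \<open>\<Phi>\<close> on \<open>[0, \<infinity>)\<close> are controlled, so \<open>\<Phi>\<close> is extended to a monotone function.\<close>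
  have "mono (\<lambda>x. \<Phi> (max 0 x))"
    using assms(1) by (auto simp: mono_on_def intro!: monoI)
  then have "(\<lambda>x. \<Phi> (max 0 x)) \<in> borel_measurable borel"
    by (rule borel_measurable_mono)
  then have "(\<lambda>x. \<Phi> (max 0 \<bar>f x\<bar>)) \<in> borel_measurable M"
    using assms(2) by measurable
  then show ?thesis by simp
qed

text \<open>
  By the \<open>\<Delta>\<^sub>2\<close> condition the integrand is at most \<open>\<Phi> (2 * max \<bar>f\<bar> \<bar>g\<bar>) \<le> K * (\<Phi> \<bar>f\<bar> + \<Phi> \<bar>g\<bar>)\<close>.
\<close>

lemma integrable_Phi_diff:
  assumes mono: "mono_on {0..} \<Phi>" and nonneg: "\<And>x. x \<ge> 0 \<Longrightarrow> \<Phi> x \<ge> 0" and "Delta2 \<Phi>"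
    and f: "f \<in> L_Phi a b \<Phi>" and g: "g \<in> L_Phi a b \<Phi>"
  shows "integrable (lebesgue_on {a..b}) (\<lambda>x. \<Phi> \<bar>f x - g x\<bar>)"
proof -
  obtain K where K: "K > 0" "\<And>x. x \<ge> 0 \<Longrightarrow> \<Phi> (2 * x) \<le> K * \<Phi> x"
    using \<open>Delta2 \<Phi>\<close> by (auto simp: Delta2_def)
  show ?thesis
  proof (rule Bochner_Integration.integrable_bound)
    show "integrable (lebesgue_on {a..b}) (\<lambda>x. K * (\<Phi> \<bar>f x\<bar> + \<Phi> \<bar>g x\<bar>))"
      using f g by (auto simp: L_Phi_def)
    show "(\<lambda>x. \<Phi> \<bar>f x - g x\<bar>) \<in> borel_measurable (lebesgue_on {a..b})"
      using f g by (intro borel_measurable_Phi_abs[OF mono]) (auto simp: L_Phi_def)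
    have "norm (\<Phi> \<bar>p - q\<bar>) \<le> norm (K * (\<Phi> \<bar>p\<bar> + \<Phi> \<bar>q\<bar>))" for p q
    proof -
      have "\<Phi> \<bar>p - q\<bar> \<le> \<Phi> (2 * max \<bar>p\<bar> \<bar>q\<bar>)"
        by (rule mono_onD[OF mono]) auto
      also have "\<dots> \<le> K * \<Phi> (max \<bar>p\<bar> \<bar>q\<bar>)" by (rule K(2)) auto
      also have "\<dots> \<le> K * (\<Phi> \<bar>p\<bar> + \<Phi> \<bar>q\<bar>)"
        using K(1) nonneg[of "\<bar>p\<bar>"] nonneg[of "\<bar>q\<bar>"] by (auto simp: max_def)
      finally show ?thesis using nonneg[of "\<bar>p - q\<bar>"] by simp
    qed
    then show "AE x in lebesgue_on {a..b}. norm (\<Phi> \<bar>f x - g x\<bar>) \<le> norm (K * (\<Phi> \<bar>f x\<bar> + \<Phi> \<bar>g x\<bar>))"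
      by simp
  qed
qed

lemma L_infinity_subset_L_Phi:
  assumes mono: "mono_on {0..} \<Phi>" and nonneg: "\<And>x. x \<ge> 0 \<Longrightarrow> \<Phi> x \<ge> 0"
  shows "L_infinity a b \<subseteq> L_Phi a b \<Phi>"
proof
  fix f assume "f \<in> L_infinity a b"
  then obtain C where f: "f \<in> borel_measurable (lebesgue_on {a..b})"
    and C: "AE x in lebesgue_on {a..b}. \<bar>f x\<bar> \<le> C"
    by (auto simp: L_infinity_def)
  have "AE x in lebesgue_on {a..b}. norm (\<Phi> \<bar>f x\<bar>) \<le> \<Phi> C"
    using C
  proof eventually_elim
    case (elim x)
    then show ?case using nonneg[of "\<bar>f x\<bar>"] mono_onD[OF mono, of "\<bar>f x\<bar>" C] by simp
  qed
  moreover have "finite_measure (lebesgue_on {a..b})"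
    by (simp add: finite_measure_lebesgue_on)
  ultimately have "integrable (lebesgue_on {a..b}) (\<lambda>x. \<Phi> \<bar>f x\<bar>)"
    using borel_measurable_Phi_abs[OF mono f]
    by (intro finite_measure.integrable_const_bound[where B = "\<Phi> C"])
  then show "f \<in> L_Phi a b \<Phi>" using f by (simp add: L_Phi_def)
qed

lemma L_Phi_override_constant:
  assumes mono: "mono_on {0..} \<Phi>" and nonneg: "\<And>x. x \<ge> 0 \<Longrightarrow> \<Phi> x \<ge> 0"
    and g: "g \<in> L_Phi a b \<Phi>" and I: "I \<in> sets lebesgue"
  shows "(\<lambda>x. if x \<in> I then m else g x) \<in> L_Phi a b \<Phi>"
proof -
  let ?u = "\<lambda>x. if x \<in> I then m else g x"
  have gm: "g \<in> borel_measurable (lebesgue_on {a..b})"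
    and gi: "integrable (lebesgue_on {a..b}) (\<lambda>x. \<Phi> \<bar>g x\<bar>)"
    using g by (auto simp: L_Phi_def)
  have "I \<inter> space (lebesgue_on {a..b}) \<in> sets (lebesgue_on {a..b})"
    using I by (auto simp: sets_restrict_space)
  then have u: "?u \<in> borel_measurable (lebesgue_on {a..b})"
    using gm by (intro measurable_If_set) auto
  have "integrable (lebesgue_on {a..b}) (\<lambda>x. \<Phi> \<bar>?u x\<bar>)"
  proof (rule Bochner_Integration.integrable_bound)
    show "integrable (lebesgue_on {a..b}) (\<lambda>x. \<Phi> \<bar>g x\<bar> + \<Phi> \<bar>m\<bar>)"
      using gi finite_measure.integrable_const[OF finite_measure_lebesgue_on] by auto
    show "(\<lambda>x. \<Phi> \<bar>?u x\<bar>) \<in> borel_measurable (lebesgue_on {a..b})"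
      by (rule borel_measurable_Phi_abs[OF mono u])
    show "AE x in lebesgue_on {a..b}. norm (\<Phi> \<bar>?u x\<bar>) \<le> norm (\<Phi> \<bar>g x\<bar> + \<Phi> \<bar>m\<bar>)"
      using nonneg by (intro AE_I2) auto
  qed
  then show ?thesis using u by (simp add: L_Phi_def)
qed

section \<open>Jumps of monotone functions and metric density\<close>

text \<open>
  The numbers \<open>l\<close> and \<open>r\<close> are the one-sided limits of \<open>h\<close>, obtained as a supremum and an infimum.
\<close>

lemma mono_on_jump:
  fixes h :: "real \<Rightarrow> real"
  assumes mono: "mono_on {a<..<b} h" and x0: "x0 \<in> {a<..<b}" and "\<not> isCont h x0"
  obtains l r where "l < r" "\<And>x. a < x \<Longrightarrow> x < x0 \<Longrightarrow> h x \<le> l" "\<And>x. x0 < x \<Longrightarrow> x < b \<Longrightarrow> r \<le> h x"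
proof -
  define l r where "l = Sup (h ` {a<..<x0})" and "r = Inf (h ` {x0<..<b})"
  have le: "h x \<le> h y" if "a < x" "x \<le> y" "y < b" for x y
    using mono_onD[OF mono, of x y] that by auto
  have bdd: "bdd_above (h ` {a<..<x0})" "bdd_below (h ` {x0<..<b})"
    using le x0 by (auto intro!: bdd_aboveI2[of _ _ "h x0"] bdd_belowI2[of _ "h x0"])
  have ne: "h ` {a<..<x0} \<noteq> {}" "h ` {x0<..<b} \<noteq> {}" using x0 by auto
  have l: "h x \<le> l" if "a < x" "x < x0" for x
    unfolding l_def using that bdd by (intro cSup_upper) auto
  have r: "r \<le> h x" if "x0 < x" "x < b" for x
    unfolding r_def using that bdd by (intro cInf_lower) auto
  have "l < r"
  proof (rule ccontr)
    assume "\<not> l < r"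
    then have rl: "r \<le> l" by simp
    have lx: "l \<le> h x0" unfolding l_def using ne le x0 by (intro cSup_least) auto
    have xr: "h x0 \<le> r" unfolding r_def using ne le x0 by (intro cInf_greatest) auto
    have "isCont h x0"
      unfolding continuous_at_eps_delta
    proof (intro allI impI)
      fix e :: real assume "e > 0"
      obtain p where p: "a < p" "p < x0" "l - e < h p"
        using less_cSupD[OF ne(1), of "l - e"] \<open>e > 0\<close> by (auto simp: l_def)
      obtain q where q: "x0 < q" "q < b" "h q < r + e"
        using cInf_lessD[OF ne(2), of "r + e"] \<open>e > 0\<close> by (auto simp: r_def)
      have "\<bar>h x - h x0\<bar> < e" if "\<bar>x - x0\<bar> < min (x0 - p) (q - x0)" for x
        using le[of p x] le[of x q] that p q rl lx xr by (auto simp: abs_less_iff)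
      then show "\<exists>d>0. \<forall>x. dist x x0 < d \<longrightarrow> dist (h x) (h x0) < e"
        using p q by (intro exI[of _ "min (x0 - p) (q - x0)"]) (auto simp: dist_real_def)
    qed
    then show False using assms(3) by simp
  qed
  then show ?thesis using that l r by blast
qed

text \<open>
  This is the limit in the form that suits estimates on a single interval: in every sufficiently
  short interval around \<open>x\<close>, the proportion of points of \<open>A\<close> exceeds \<open>\<theta>\<close>.
\<close>

lemma metric_density_one_lower_bound:
  assumes "has_metric_density A 1 x" and "\<theta> < 1"
  obtains e where "e > 0" "\<And>I. is_interval I \<Longrightarrow> x \<in> I \<Longrightarrow> 0 < measure lebesgue I \<Longrightarrow>
    measure lebesgue I < e \<Longrightarrow> \<theta> * measure lebesgue I < measure lebesgue (A \<inter> I)"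
proof -
  have "eventually (\<lambda>I. \<theta> < measure lebesgue (A \<inter> I) / measure lebesgue I) (shrinking_intervals x)"
    using assms unfolding has_metric_density_def by (auto dest: order_tendstoD(1))
  then obtain Q where Q: "eventually Q (at_right 0)"
    "\<And>I. Q (measure lebesgue I) \<Longrightarrow> is_interval I \<Longrightarrow> x \<in> I \<Longrightarrow>
      \<theta> < measure lebesgue (A \<inter> I) / measure lebesgue I"
    unfolding shrinking_intervals_def eventually_inf_principal eventually_filtercomap by auto
  then obtain e where "e > 0" "\<And>y. 0 < y \<Longrightarrow> y < e \<Longrightarrow> Q y"
    unfolding eventually_at_right_field by auto
  then have "\<theta> * measure lebesgue I < measure lebesgue (A \<inter> I)"
    if "is_interval I" "x \<in> I" "0 < measure lebesgue I" "measure lebesgue I < e" for I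
    using Q(2)[of I] that by (simp add: pos_less_divide_eq)
  with \<open>e > 0\<close> show ?thesis by (rule that)
qed

lemma is_interval_sets_lebesgue: "is_interval I \<Longrightarrow> I \<in> sets lebesgue" for I :: "real set"
  using real_interval_borel_measurable[of I] by (simp add: sets_completionI_sets)

section \<open>Local improvement of an approximant\<close>

text \<open>
  Let \<open>A\<close> be the set where \<open>\<bar>f - f x0\<bar> < \<delta>\<close>. If \<open>m\<close> is nearer to \<open>f x0\<close> than the values of \<open>g\<close> on \<open>I\<close>
  are, by a margin of \<open>3 * \<delta>\<close>, then on \<open>A \<inter> I\<close> two of the three \<open>\<delta>\<close> compensate for replacing \<open>f\<close> by
  \<open>f x0\<close>, and the third one gives a gain of at least
  \<open>\<kappa> = \<Phi> (\<bar>f x0 - m\<bar> + 2 * \<delta>) - \<Phi> (\<bar>f x0 - m\<bar> + \<delta>) > 0\<close>. Off \<open>A\<close> the loss is at most \<open>C\<close>. The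
  threshold \<open>e\<close> is independent of \<open>g\<close> and of the side of \<open>x0\<close> on which \<open>I\<close> extends, so
  one argument serves both directions of the jump.
\<close>

lemma Phi_distance_improvement:
  fixes m R \<delta> :: real
  assumes mono: "strict_mono_on {0..} \<Phi>" and nonneg: "\<And>x. x \<ge> 0 \<Longrightarrow> \<Phi> x \<ge> 0" and "Delta2 \<Phi>"
    and f: "f \<in> L_Phi a b \<Phi>"
    and loss: "AE x in lebesgue_on {a..b}.
      \<forall>y z. \<bar>y\<bar> \<le> R \<longrightarrow> \<bar>z\<bar> \<le> R \<longrightarrow> \<Phi> \<bar>f x - y\<bar> \<le> \<Phi> \<bar>f x - z\<bar> + C"
    and "approx_continuous_at a b f x0" "\<delta> > 0" "\<bar>m\<bar> \<le> R"
  obtains e where "e > 0"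
    "\<And>I g. is_interval I \<Longrightarrow> I \<subseteq> {a..b} \<Longrightarrow> x0 \<in> I \<Longrightarrow> 0 < measure lebesgue I \<Longrightarrow> measure lebesgue I < e \<Longrightarrow>
      g \<in> L_Phi a b \<Phi> \<Longrightarrow>
      AE x in lebesgue_on {a..b}. x \<in> I \<longrightarrow> \<bar>g x\<bar> \<le> R \<and> \<bar>f x0 - m\<bar> + 3 * \<delta> \<le> \<bar>f x0 - g x\<bar> \<Longrightarrow>
      Phi_distance a b \<Phi> f (\<lambda>x. if x \<in> I then m else g x) < Phi_distance a b \<Phi> f g"
proof -
  let ?L = "lebesgue_on {a..b}"
  define A where "A = {x \<in> {a..b}. \<bar>f x - f x0\<bar> < \<delta>}"
  define \<kappa> where "\<kappa> = \<Phi> (\<bar>f x0 - m\<bar> + 2 * \<delta>) - \<Phi> (\<bar>f x0 - m\<bar> + \<delta>)"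
  \<comment> \<open>A nonnegative bound for the loss puts the proportion \<open>D / (\<kappa> + D)\<close> into \<open>[0, 1)\<close>.\<close>
  define D where "D = max C 0"
  have mono': "mono_on {0..} \<Phi>" using mono by (rule strict_mono_on_imp_mono_on)
  have \<kappa>: "\<kappa> > 0" using mono \<open>\<delta> > 0\<close> by (auto simp: \<kappa>_def strict_mono_on_def)
  have D: "D \<ge> 0" "C \<le> D" by (auto simp: D_def)
  have fm: "f \<in> borel_measurable ?L" using f by (simp add: L_Phi_def)
  have "{x \<in> space ?L. \<bar>f x - f x0\<bar> < \<delta>} \<in> sets ?L" using fm by measurable
  then have A: "A \<in> sets lebesgue"
    by (simp add: A_def sets_restrict_space_iff)
  have "has_metric_density A 1 x0"
    using assms(6,7) by (simp add: approx_continuous_at_def A_def)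
  \<comment> \<open>At this proportion of \<open>A\<close> in \<open>I\<close>, the gain \<open>\<kappa>\<close> on \<open>A\<close> and the loss \<open>D\<close> off \<open>A\<close> balance.\<close>
  moreover have "D / (\<kappa> + D) < 1" using \<kappa> D by simp
  ultimately obtain e where e: "e > 0" "\<And>I. is_interval I \<Longrightarrow> x0 \<in> I \<Longrightarrow> 0 < measure lebesgue I \<Longrightarrow>
    measure lebesgue I < e \<Longrightarrow> D / (\<kappa> + D) * measure lebesgue I < measure lebesgue (A \<inter> I)"
    using metric_density_one_lower_bound by blast
  have "Phi_distance a b \<Phi> f (\<lambda>x. if x \<in> I then m else g x) < Phi_distance a b \<Phi> f g"
    if I: "is_interval I" "I \<subseteq> {a..b}" "x0 \<in> I" "0 < measure lebesgue I" "measure lebesgue I < e"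
      and g: "g \<in> L_Phi a b \<Phi>"
      and far: "AE x in ?L. x \<in> I \<longrightarrow> \<bar>g x\<bar> \<le> R \<and> \<bar>f x0 - m\<bar> + 3 * \<delta> \<le> \<bar>f x0 - g x\<bar>" for I g
  proof -
    let ?u = "\<lambda>x. if x \<in> I then m else g x"
    have Im: "I \<in> sets lebesgue"
      using I(1) by (rule is_interval_sets_lebesgue)
    have int_g: "integrable ?L (\<lambda>x. \<Phi> \<bar>f x - g x\<bar>)"
      by (rule integrable_Phi_diff[OF mono' nonneg \<open>Delta2 \<Phi>\<close> f g])
    have int_u: "integrable ?L (\<lambda>x. \<Phi> \<bar>f x - ?u x\<bar>)"
      by (rule integrable_Phi_diff[OF mono' nonneg \<open>Delta2 \<Phi>\<close> f L_Phi_override_constant[OF mono' nonneg g Im]])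
    have sets: "A \<inter> I \<in> sets ?L" "I \<in> sets ?L"
      using A Im I(2) by (auto simp: sets_restrict_space A_def)
    have fin: "finite_measure ?L" by (simp add: finite_measure_lebesgue_on)
    have ind: "integrable ?L (indicat_real (A \<inter> I))" "integrable ?L (indicat_real I)"
      using sets fin by (auto simp: finite_measure.emeasure_finite less_top[symmetric] 
          intro!: integrable_real_indicator)
    have meas: "measure ?L (A \<inter> I) = measure lebesgue (A \<inter> I)" "measure ?L I = measure lebesgue I"
      using I(2) by (auto intro!: measure_restrict_space)
    have "0 < (\<kappa> + D) * measure lebesgue (A \<inter> I) - D * measure lebesgue I"
      using e(2)[OF I(1,3,4,5)] \<kappa> D by (simp add: field_simps)
    \<comment> \<open>The integrand is \<open>\<kappa>\<close> on \<open>A \<inter> I\<close>, \<open>- D\<close> on \<open>I - A\<close>, and \<open>0\<close> elsewhere.\<close>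
    also have "\<dots> = (LINT x|?L. (\<kappa> + D) * indicat_real (A \<inter> I) x - D * indicat_real I x)"
      using ind meas sets.Int_space_eq2[OF sets(1)] sets.Int_space_eq2[OF sets(2)] by simp
    also have "\<dots> \<le> (LINT x|?L. \<Phi> \<bar>f x - g x\<bar> - \<Phi> \<bar>f x - ?u x\<bar>)"
    proof (rule integral_mono_AE)
      show "AE x in ?L. (\<kappa> + D) * indicat_real (A \<inter> I) x - D * indicat_real I x
          \<le> \<Phi> \<bar>f x - g x\<bar> - \<Phi> \<bar>f x - ?u x\<bar>"
        using far loss
      proof eventually_elim
        case (elim x)
        consider "x \<notin> I" | "x \<in> I" "x \<notin> A" | "x \<in> I" "x \<in> A" by blast
        then show ?case
        proof cases
          case 2
          then have "\<Phi> \<bar>f x - m\<bar> \<le> \<Phi> \<bar>f x - g x\<bar> + C" using elim \<open>\<bar>m\<bar> \<le> R\<close> by blast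
          then show ?thesis using 2 D by simp
        next
          case 3
          then have "\<bar>f x - f x0\<bar> < \<delta>" by (simp add: A_def)
          then have "\<bar>f x - m\<bar> \<le> \<bar>f x0 - m\<bar> + \<delta>" "\<bar>f x0 - m\<bar> + 2 * \<delta> \<le> \<bar>f x - g x\<bar>"
            using elim(1) 3 by auto
          then have "\<Phi> \<bar>f x - m\<bar> \<le> \<Phi> (\<bar>f x0 - m\<bar> + \<delta>)" "\<Phi> (\<bar>f x0 - m\<bar> + 2 * \<delta>) \<le> \<Phi> \<bar>f x - g x\<bar>"
            using \<open>\<delta> > 0\<close> by (auto intro!: mono_onD[OF mono'])
          then show ?thesis using 3 by (simp add: \<kappa>_def)
        qed simp
      qed
    qed (use ind int_g int_u in auto)
    also have "\<dots> = Phi_distance a b \<Phi> f g - Phi_distance a b \<Phi> f ?u"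
      using int_g int_u by (simp add: Phi_distance_def)
    finally show ?thesis by simp
  qed
  with e(1) show ?thesis using that by blast
qed

section \<open>Optimality excludes jumps\<close>

text \<open>
  An infimum of reals is a lower bound only if the values are bounded below; here \<open>0\<close> is a bound.
\<close>

lemma best_approximant_le:
  assumes nonneg: "\<And>x. x \<ge> 0 \<Longrightarrow> \<Phi> x \<ge> 0"
    and g: "g \<in> best_approximants a b \<Phi> f" and u: "u \<in> M_Phi a b \<Phi>"
  shows "Phi_distance a b \<Phi> f g \<le> Phi_distance a b \<Phi> f u"
proof -
  have "Phi_distance a b \<Phi> f v \<ge> 0" for v
    unfolding Phi_distance_def using nonneg by (intro Bochner_Integration.integral_nonneg) auto
  then have "bdd_below (Phi_distance a b \<Phi> f ` M_Phi a b \<Phi>)" by (intro bdd_belowI2[of _ 0])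
  then show ?thesis using g u by (auto simp: best_approximants_def intro: cINF_lower)
qed

text \<open>
  The hypothesis \<open>loss\<close> is the common consequence of the boundedness of \<open>f\<close> and of the boundedness of
  \<open>\<phi>\<close>: moving the approximating value within a bounded range changes the integrand by a bounded
  amount, uniformly in the value of \<open>f\<close>.
\<close>

lemma isCont_best_approximant:
  assumes mono: "strict_mono_on {0..} \<Phi>" and nonneg: "\<And>x. x \<ge> 0 \<Longrightarrow> \<Phi> x \<ge> 0" and "Delta2 \<Phi>"
    and f: "f \<in> L_Phi a b \<Phi>"
    and loss: "\<And>R. \<exists>C. AE x in lebesgue_on {a..b}.
      \<forall>y z. \<bar>y\<bar> \<le> R \<longrightarrow> \<bar>z\<bar> \<le> R \<longrightarrow> \<Phi> \<bar>f x - y\<bar> \<le> \<Phi> \<bar>f x - z\<bar> + C"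
    and x0: "x0 \<in> {a<..<b}" and ac: "approx_continuous_at a b f x0"
    and best: "g \<in> best_approximants a b \<Phi> f" and rep: "nondecreasing_rep a b g h"
  shows "isCont h x0"
proof (rule ccontr)
  assume "\<not> isCont h x0"
  let ?L = "lebesgue_on {a..b}"
  have mono': "mono_on {0..} \<Phi>" using mono by (rule strict_mono_on_imp_mono_on)
  have hm: "mono_on {a<..<b} h" and gh: "AE x in ?L. g x = h x"
    using rep by (auto simp: nondecreasing_rep_def)
  have g: "g \<in> L_Phi a b \<Phi>" using best by (simp add: best_approximants_def M_Phi_def)
  obtain l r where "l < r" and l: "\<And>x. a < x \<Longrightarrow> x < x0 \<Longrightarrow> h x \<le> l"
    and r: "\<And>x. x0 < x \<Longrightarrow> x < b \<Longrightarrow> r \<le> h x"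
    using mono_on_jump[OF hm x0 \<open>\<not> isCont h x0\<close>] by blast
  \<comment> \<open>\<open>h\<close> may be unbounded near \<open>a\<close> and \<open>b\<close>, so the replacement is confined to \<open>[p, q]\<close>.\<close>
  define p q where "p = (a + x0) / 2" and "q = (x0 + b) / 2"
  have pq: "a < p" "p < x0" "x0 < q" "q < b" using x0 by (auto simp: p_def q_def)
  define R where "R = max (max \<bar>h p\<bar> \<bar>h q\<bar>) (max \<bar>f x0\<bar> (max \<bar>l\<bar> \<bar>r\<bar>))"
  have R: "\<bar>f x0\<bar> \<le> R" "\<bar>l\<bar> \<le> R" "\<bar>r\<bar> \<le> R"
    by (simp_all add: R_def le_max_iff_disj)
  have hR: "\<bar>h x\<bar> \<le> R" if "x \<in> {p..q}" for x
  proof -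
    have "h p \<le> h x" "h x \<le> h q"
      using pq that by (auto intro!: mono_onD[OF hm])
    then have "\<bar>h x\<bar> \<le> max \<bar>h p\<bar> \<bar>h q\<bar>" by linarith
    also have "\<dots> \<le> R" unfolding R_def by (rule max.cobounded1)
    finally show ?thesis .
  qed
  \<comment> \<open>The value \<open>h x0\<close> may lie anywhere in the gap, possibly nearer to \<open>f x0\<close> than \<open>m\<close> is.\<close>
  have null: "AE x in ?L. x \<noteq> x0"
    using AE_completion[OF AE_lborel_singleton[of x0]] by (auto simp: AE_restrict_space_iff)
  \<comment> \<open>The intervals \<open>J e\<close> may extend to either side of \<open>x0\<close>; both directions of the jump use this.\<close>
  have contra: False
    if m: "\<bar>m\<bar> \<le> R" "l \<le> m" "m \<le> r" and "\<delta> > 0"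
      and J: "\<And>e. e > 0 \<Longrightarrow> is_interval (J e) \<and> J e \<subseteq> {p..q} \<and> x0 \<in> J e \<and>
          0 < measure lebesgue (J e) \<and> measure lebesgue (J e) < e"
      and far: "\<And>e x. e > 0 \<Longrightarrow> x \<in> J e \<Longrightarrow> x \<noteq> x0 \<Longrightarrow> \<bar>f x0 - m\<bar> + 3 * \<delta> \<le> \<bar>f x0 - h x\<bar>"
    for m \<delta> J
  proof -
    obtain C where C: "AE x in ?L. \<forall>y z. \<bar>y\<bar> \<le> R \<longrightarrow> \<bar>z\<bar> \<le> R \<longrightarrow> \<Phi> \<bar>f x - y\<bar> \<le> \<Phi> \<bar>f x - z\<bar> + C"
      using loss by blast
    show False
    proof (rule Phi_distance_improvement[OF mono nonneg \<open>Delta2 \<Phi>\<close> f C ac \<open>\<delta> > 0\<close> m(1)])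
      fix e
      assume e: "e > 0"
        "\<And>I g. is_interval I \<Longrightarrow> I \<subseteq> {a..b} \<Longrightarrow> x0 \<in> I \<Longrightarrow> 0 < measure lebesgue I \<Longrightarrow>
          measure lebesgue I < e \<Longrightarrow> g \<in> L_Phi a b \<Phi> \<Longrightarrow>
          AE x in ?L. x \<in> I \<longrightarrow> \<bar>g x\<bar> \<le> R \<and> \<bar>f x0 - m\<bar> + 3 * \<delta> \<le> \<bar>f x0 - g x\<bar> \<Longrightarrow>
          Phi_distance a b \<Phi> f (\<lambda>x. if x \<in> I then m else g x) < Phi_distance a b \<Phi> f g"
      define I where "I = J e"
      have I: "is_interval I" "I \<subseteq> {p..q}" "x0 \<in> I" "0 < measure lebesgue I" "measure lebesgue I < e"
        using J[OF e(1)] by (auto simp: I_def)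
      let ?u = "\<lambda>x. if x \<in> I then m else g x"
      let ?v = "\<lambda>x. if x \<in> I then m else h x"
      have less: "Phi_distance a b \<Phi> f ?u < Phi_distance a b \<Phi> f g"
      proof (rule e(2)[OF I(1) _ I(3,4,5) g])
        show "I \<subseteq> {a..b}" using I(2) pq by auto
        show "AE x in ?L. x \<in> I \<longrightarrow> \<bar>g x\<bar> \<le> R \<and> \<bar>f x0 - m\<bar> + 3 * \<delta> \<le> \<bar>f x0 - g x\<bar>"
          using gh null
        proof eventually_elim
          case (elim x)
          then show ?case using hR[of x] far[OF e(1), of x] I(2) by (auto simp: I_def)
        qed
      qed
      have "mono_on {a<..<b} ?v"
      proof (rule mono_onI)
        fix x y assume xy: "x \<in> {a<..<b}" "y \<in> {a<..<b}" "x \<le> y"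
        have left: "x < x0" if "x \<notin> I" "y \<in> I"
          using that I(1,3) xy unfolding is_interval_1 by (metis not_less)
        have right: "x0 < y" if "x \<in> I" "y \<notin> I"
          using that I(1,3) xy unfolding is_interval_1 by (metis not_less)
        show "?v x \<le> ?v y"
        proof (cases "x \<in> I"; cases "y \<in> I")
          assume "x \<in> I" "y \<notin> I"
          then show ?thesis using right r[of y] m(3) xy(2) by simp
        next
          assume "x \<notin> I" "y \<in> I"
          then show ?thesis using left l[of x] m(2) xy(1) by simp
        next
          assume "x \<notin> I" "y \<notin> I"
          then show ?thesis using mono_onD[OF hm xy] by simp
        qed simp
      qed
      moreover have "AE x in ?L. ?u x = ?v x" using gh by eventually_elim simp
      moreover have "?u \<in> L_Phi a b \<Phi>"
        by (rule L_Phi_override_constant[OF mono' nonneg g is_interval_sets_lebesgue[OF I(1)]])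
      ultimately have "?u \<in> M_Phi a b \<Phi>" unfolding M_Phi_def nondecreasing_rep_def by blast
      then show False using best_approximant_le[OF nonneg best] less by force
    qed
  qed
  show False
  proof (cases "l < f x0")
    case True
    define m where "m = min (f x0) r"
    show False
    proof (rule contra)
      show "\<bar>m\<bar> \<le> R" "l \<le> m" "m \<le> r" "(m - l) / 3 > 0"
        using True \<open>l < r\<close> R by (simp_all add: m_def min_def)
      show "is_interval {max p (x0 - e / 2)..x0} \<and> {max p (x0 - e / 2)..x0} \<subseteq> {p..q} \<and>
          x0 \<in> {max p (x0 - e / 2)..x0} \<and> 0 < measure lebesgue {max p (x0 - e / 2)..x0} \<and>
          measure lebesgue {max p (x0 - e / 2)..x0} < e" if "e > 0" for e
        using that pq by (auto simp: is_interval_cc max_def)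
      show "\<bar>f x0 - m\<bar> + 3 * ((m - l) / 3) \<le> \<bar>f x0 - h x\<bar>"
        if "x \<in> {max p (x0 - e / 2)..x0}" "x \<noteq> x0" for e x
        using l[of x] that pq True by (auto simp: m_def min_def diff_divide_distrib)
    qed
  next
    case False
    show False
    proof (rule contra)
      show "\<bar>l\<bar> \<le> R" "l \<le> l" "l \<le> r" "(r - l) / 3 > 0"
        using \<open>l < r\<close> R by simp_all
      show "is_interval {x0..min q (x0 + e / 2)} \<and> {x0..min q (x0 + e / 2)} \<subseteq> {p..q} \<and>
          x0 \<in> {x0..min q (x0 + e / 2)} \<and> 0 < measure lebesgue {x0..min q (x0 + e / 2)} \<and>
          measure lebesgue {x0..min q (x0 + e / 2)} < e" if "e > 0" for e
        using that pq by (auto simp: is_interval_cc min_def)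
      show "\<bar>f x0 - l\<bar> + 3 * ((r - l) / 3) \<le> \<bar>f x0 - h x\<bar>"
        if "x \<in> {x0..min q (x0 + e / 2)}" "x \<noteq> x0" for e x
        using r[of x] that pq False \<open>l < r\<close> by (auto simp: diff_divide_distrib)
    qed
  qed
qed

theorem theorem4p2:
  fixes a b x0 :: real and \<Phi> f :: "real \<Rightarrow> real"
  assumes "a < b"
    and "Delta2 \<Phi>"
    and "(N_function \<Phi> \<and> f \<in> L_infinity a b) \<or> (N_inf_function \<Phi> \<and> f \<in> L_Phi a b \<Phi>)"
    and "f \<notin> M_Phi a b \<Phi>"
    and "x0 \<in> {a<..<b}"
    and "approx_continuous_at a b f x0"
  shows "\<forall>g\<in>best_approximants a b \<Phi> f. \<forall>h. nondecreasing_rep a b g h \<longrightarrow> isCont h x0"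
proof -
  let ?L = "lebesgue_on {a..b}"
  have "\<exists>\<phi>. continuous_on {0..} \<phi> \<and> (\<forall>t>0. \<phi> t > 0) \<and> \<phi> 0 \<ge> 0 \<and> (\<forall>x\<ge>0. \<Phi> x = integral {0..x} \<phi>) \<and>
      (f \<in> L_infinity a b \<or> f \<in> L_Phi a b \<Phi> \<and> bounded (\<phi> ` {0..}))"
    using assms(3) by (auto simp: N_function_def N_inf_function_def class_F_def class_F_inf_def)
  then obtain \<phi> where \<phi>: "continuous_on {0..} \<phi>" "\<And>t. t > 0 \<Longrightarrow> \<phi> t > 0" "\<phi> 0 \<ge> 0"
      "\<And>x. x \<ge> 0 \<Longrightarrow> \<Phi> x = integral {0..x} \<phi>"
    and cases: "f \<in> L_infinity a b \<or> f \<in> L_Phi a b \<Phi> \<and> bounded (\<phi> ` {0..})"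
    by blast
  note mono = primitive_strict_mono_on[OF \<phi>] and nonneg = primitive_nonneg[OF \<phi>]
  have mono': "mono_on {0..} \<Phi>" using mono by (rule strict_mono_on_imp_mono_on)
  have f: "f \<in> L_Phi a b \<Phi>"
    using cases L_infinity_subset_L_Phi[OF mono' nonneg] by blast
  have loss: "\<exists>C. AE x in ?L. \<forall>y z. \<bar>y\<bar> \<le> R \<longrightarrow> \<bar>z\<bar> \<le> R \<longrightarrow> \<Phi> \<bar>f x - y\<bar> \<le> \<Phi> \<bar>f x - z\<bar> + C" for R
    using cases
  proof
    assume "f \<in> L_infinity a b"
    then obtain B where B: "AE x in ?L. \<bar>f x\<bar> \<le> B" by (auto simp: L_infinity_def)
    have "AE x in ?L. \<forall>y z. \<bar>y\<bar> \<le> R \<longrightarrow> \<bar>z\<bar> \<le> R \<longrightarrow> \<Phi> \<bar>f x - y\<bar> \<le> \<Phi> \<bar>f x - z\<bar> + \<Phi> (B + R)"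
      using B
    proof eventually_elim
      case (elim x)
      have "\<Phi> \<bar>f x - y\<bar> \<le> \<Phi> (B + R)" if "\<bar>y\<bar> \<le> R" for y
        using elim that by (intro mono_onD[OF mono']) auto
      then show ?case using nonneg by (smt (verit) abs_ge_zero)
    qed
    then show ?thesis by blast
  next
    assume "f \<in> L_Phi a b \<Phi> \<and> bounded (\<phi> ` {0..})"
    then obtain K where K: "\<And>t. t \<ge> 0 \<Longrightarrow> \<phi> t \<le> K"
      unfolding bounded_iff by (auto simp: abs_le_iff)
    have "K \<ge> 0" using K[of 0] \<phi>(3) by simp
    have "\<Phi> \<bar>s - y\<bar> \<le> \<Phi> \<bar>s - z\<bar> + K * (2 * R)" if "\<bar>y\<bar> \<le> R" "\<bar>z\<bar> \<le> R" for s y z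
    proof (cases "\<bar>s - y\<bar> \<le> \<bar>s - z\<bar>")
      case True
      then have "\<Phi> \<bar>s - y\<bar> \<le> \<Phi> \<bar>s - z\<bar>" by (intro mono_onD[OF mono']) auto
      moreover have "0 \<le> K * (2 * R)" using \<open>K \<ge> 0\<close> that by auto
      ultimately show ?thesis by simp
    next
      case False
      then have "\<Phi> \<bar>s - y\<bar> - \<Phi> \<bar>s - z\<bar> \<le> K * (\<bar>s - y\<bar> - \<bar>s - z\<bar>)"
        by (intro primitive_increment_le[OF \<phi> K]) auto
      also have "\<dots> \<le> K * (2 * R)" using \<open>K \<ge> 0\<close> that by (intro mult_left_mono) auto
      finally show ?thesis by simp
    qed
    then show ?thesis by blast
  qed
  show ?thesis
    using isCont_best_approximant[OF mono nonneg assms(2) f loss assms(5,6)] by blast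
qed

end
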